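(* Let $n,k$ be integers with $1\le k\le \frac n2-1$, and let $T\in\mathcal T_{n,k}$. Put $\Delta=\left\lfloor \frac{n-2}{k}\right\rfloor+1$, $p=\left\lfloor \frac{n-2-k(\Delta-1)}{\Delta-2}\right\rfloor$ and $\mu=n-1-k(\Delta-1)-p(\Delta-2)$. Then $$\prod\nolimits_2(T)\ \le\ \Delta^{k\Delta}(\Delta-1)^{p(\Delta-1)}\mu^{\mu},$$ and equality holds if and only if the degree sequence of $T$ is $$(\underbrace{\Delta,\ldots,\Delta}_{k},\underbrace{\Delta-1,\ldots,\Delta-1}_{p},\mu,\underbrace{1,\ldots,1}_{n-k-p-1}).$$
   Context: All graphs are finite, simple, connected and undirected; $d(v)$ denotes the degree of a vertex $v$. $\mathcal T_{n,k}$ is the class of trees with $n$ vertices in which exactly $k$ vertices have degree equal to the maximum vertex degree of the tree. The second multiplicative Zagreb index of a graph $G$ is $\prod_2(G)=\prod_{uv\in E(G)}d(u)d(v)=\prod_{u\in V(G)}d(u)^{d(u)}$. The degree sequence of a graph is the list of its vertex degrees in non-increasing order. *)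

theory Defs
  imports Complex_Main "HOL-Library.Multiset" "Graph_Theory.Graph_Theory"
begin

text \<open>
  Finite simple undirected graphs are the symmetric loop-free finite digraphs of the locale
  \<open>pair_graph\<close>: an undirected edge is a pair of opposite arcs, so the degree of a vertex is its
  \<open>out_degree\<close>.
\<close>

abbreviation deg :: "'a pair_pre_digraph \<Rightarrow> 'a \<Rightarrow> nat" where
  "deg G v \<equiv> out_degree (with_proj G) v"

definition uedges :: "'a pair_pre_digraph \<Rightarrow> 'a set set" where
  "uedges G = {{u, v} | u v. (u, v) \<in> parcs G}"

text \<open>
  The library predicate \<open>tree\<close> is not usable for symmetric digraphs, because there every edge
  yields a directed cycle \<open>u, v, u\<close> of length two.  The cycles of the undirected graph are the
  directed cycles of length at least three.
\<close>

definition undirected_tree :: "'a pair_pre_digraph \<Rightarrow> bool" where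
  "undirected_tree G \<longleftrightarrow>
     pair_graph G \<and> connected (with_proj G) \<and>
     \<not> (\<exists>c. pre_digraph.cycle (with_proj G) c \<and> 3 \<le> length c)"

definition max_deg :: "'a pair_pre_digraph \<Rightarrow> nat" where
  "max_deg G = Max (deg G ` pverts G)"

definition tree_class :: "nat \<Rightarrow> nat \<Rightarrow> 'a pair_pre_digraph set" where
  "tree_class n k =
     {G. undirected_tree G \<and> card (pverts G) = n \<and>
         card {v \<in> pverts G. deg G v = max_deg G} = k}"

text \<open>Since there are no loops, the inner product over an edge \<open>{u, v}\<close> is \<open>deg G u * deg G v\<close>.\<close>

definition zagreb2_mult :: "'a pair_pre_digraph \<Rightarrow> nat" where
  "zagreb2_mult G = (\<Prod>e\<in>uedges G. \<Prod>v\<in>e. deg G v)"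

definition degree_sequence :: "'a pair_pre_digraph \<Rightarrow> nat list" where
  "degree_sequence G =
     rev (sorted_list_of_multiset (image_mset (deg G) (mset_set (pverts G))))"

text \<open>
  The parameters \<open>\<Delta>\<close>, \<open>p\<close> and \<open>\<mu>\<close> can be computed in the natural numbers: in the relevant range
  the divisors are positive, no subtraction is truncated and \<open>div\<close> is the floor of the quotient.
\<close>

lemma parameters_nat:
  fixes n k \<Delta> p \<mu> :: nat
  assumes "1 \<le> k" and "real k \<le> real n / 2 - 1"
    and \<Delta>: "\<Delta> = (n - 2) div k + 1"
    and p: "p = (n - 2 - k * (\<Delta> - 1)) div (\<Delta> - 2)"
    and \<mu>: "\<mu> = n - 1 - k * (\<Delta> - 1) - p * (\<Delta> - 2)"
  shows "int \<Delta> = \<lfloor>(real n - 2) / real k\<rfloor> + 1" and "3 \<le> \<Delta>"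
    and "int p = \<lfloor>(real n - 2 - real k * (real \<Delta> - 1)) / (real \<Delta> - 2)\<rfloor>"
    and "int \<mu> = int n - 1 - int k * (int \<Delta> - 1) - int p * (int \<Delta> - 2)"
    and "1 \<le> \<mu>" and "k + p + 1 \<le> n"
proof -
  have n: "2 * k + 2 \<le> n" using assms(2) by linarith
  have "2 \<le> (n - 2) div k"
    using n assms(1) by (simp add: less_eq_div_iff_mult_less_eq)
  then show D3: "3 \<le> \<Delta>" using \<Delta> by simp
  have kD: "k * (\<Delta> - 1) \<le> n - 2" using \<Delta> by simp
  have pD: "p * (\<Delta> - 2) \<le> n - 2 - k * (\<Delta> - 1)" unfolding p by simp
  show "int \<Delta> = \<lfloor>(real n - 2) / real k\<rfloor> + 1"
    using n floor_divide_of_nat_eq[of "n - 2" k, where ?'a = real]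
    by (simp add: \<Delta> of_nat_diff)
  have "real (n - 2 - k * (\<Delta> - 1)) = real n - 2 - real k * (real \<Delta> - 1)"
    using kD D3 n by (simp add: of_nat_diff)
  moreover have "real (\<Delta> - 2) = real \<Delta> - 2" using D3 by simp
  ultimately show "int p = \<lfloor>(real n - 2 - real k * (real \<Delta> - 1)) / (real \<Delta> - 2)\<rfloor>"
    using floor_divide_of_nat_eq[of "n - 2 - k * (\<Delta> - 1)" "\<Delta> - 2", where ?'a = real]
    by (simp only: p)
  show "1 \<le> \<mu>" using kD pD n \<mu> by linarith
  have "k * (\<Delta> - 1) + p * (\<Delta> - 2) \<le> n - 1" using kD pD n by linarith
  then have "int \<mu> = int n - 1 - int (k * (\<Delta> - 1)) - int (p * (\<Delta> - 2))"
    unfolding \<mu> using n by linarith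
  then show "int \<mu> = int n - 1 - int k * (int \<Delta> - 1) - int p * (int \<Delta> - 2)"
    using D3 by (simp add: of_nat_diff)
  have "k * 1 \<le> k * (\<Delta> - 1)" "p * 1 \<le> p * (\<Delta> - 2)"
    using D3 by (intro mult_le_mono; simp)+
  then show "k + p + 1 \<le> n" using kD pD n by linarith
qed

end

theory Submission
  imports Defs
begin

text \<open>
  With \<open>x\<^sub>v = d(v) - 1\<close> and \<open>f x = (x + 1) ^ (x + 1)\<close>, a tree satisfies \<open>(\<Sum>v. x\<^sub>v) = n - 2\<close> and
  its index is \<open>\<Prod>v. f x\<^sub>v\<close>, where \<open>f\<close> is strictly log-convex. For summands bounded by \<open>M\<close>, pushing
  two of them apart increases the product, so the greedy choice (as many \<open>M\<close> as possible, one
  remainder, then zeros) is the unique maximum; its value is a function of \<open>M\<close> and of the sum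
  alone. Put \<open>D = \<Delta> - 1\<close>, the largest possible value of \<open>max x\<^sub>v\<close>. If it is attained,
  the greedy bound with \<open>M = D - 1\<close> applies to the other \<open>n - k\<close> summands. If it is not attained,
  that bound applies to all summands, and trading \<open>k\<close> units of \<open>D\<close> in the sum for \<open>k\<close> factors
  \<open>f D\<close> strictly increases it.
\<close>

subsection \<open>Products of self-powers with a given sum\<close>

definition self_power :: "nat \<Rightarrow> nat" where
  "self_power x = (x + 1) ^ (x + 1)"

lemma self_power_pos: "0 < self_power x"
  by (simp add: self_power_def)

lemma self_power_0: "self_power 0 = 1"
  by (simp add: self_power_def)

text \<open>Put N = x + 2. The right side over the left is (1 - 1/N^2)^(x+1) * (1 + 1/N)^2, and
  Bernoulli's inequality bounds the first factor below by 1 - (N-1)/N^2.\<close>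

lemma self_power_log_convex: "self_power (x + 1) ^ 2 < self_power x * self_power (x + 2)"
proof -
  define N where "N = real x + 2"
  have N: "2 \<le> N" by (simp add: N_def)
  have b: "- 1 \<le> - 1 / N\<^sup>2"
    using N by (auto simp: divide_simps)
  have "1 < (1 - (N - 1) / N\<^sup>2) * (1 + 1 / N)\<^sup>2"
  proof -
    \<comment> \<open>The left side is (N^2 - N + 1) * (N + 1)^2 / N^4, and (N^2 - N + 1) * (N + 1)
      = N^3 + 1.\<close>
    have "(1 - (N - 1) / N\<^sup>2) * (1 + 1 / N)\<^sup>2 = 1 + (N ^ 3 + N + 1) / N ^ 4"
      using N by (simp add: field_simps) (simp add: eval_nat_numeral algebra_simps)
    moreover have "0 < (N ^ 3 + N + 1) / N ^ 4" using N by (intro divide_pos_pos add_pos_pos) auto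
    ultimately show ?thesis by linarith
  qed
  also have "\<dots> \<le> (1 + - 1 / N\<^sup>2) ^ (x + 1) * (1 + 1 / N)\<^sup>2"
    using Bernoulli_inequality[OF b, of "x + 1"] N
    by (intro mult_right_mono) (auto simp: N_def field_simps)
  also have "\<dots> = (N - 1) ^ (x + 1) * (N + 1) ^ (x + 3) / N ^ (2 * (x + 2))"
  proof -
    have "1 + - 1 / N\<^sup>2 = (N - 1) * (N + 1) / N\<^sup>2" "1 + 1 / N = (N + 1) / N"
      using N by (simp_all add: field_simps power2_eq_square)
    moreover have "(N\<^sup>2) ^ (x + 1) * N\<^sup>2 = N ^ (2 * (x + 2))"
      by (simp flip: power_mult power_add)
    moreover have "(N + 1) ^ (x + 1) * (N + 1)\<^sup>2 = (N + 1) ^ (x + 3)"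
      by (simp flip: power_add) (simp add: numeral_eq_Suc)
    ultimately show ?thesis
      by (simp add: power_divide power_mult_distrib del: power_Suc power_add)
  qed
  finally have "N ^ (2 * (x + 2)) < (N - 1) ^ (x + 1) * (N + 1) ^ (x + 3)"
    using N by (simp add: divide_simps)
  then have "real (self_power (x + 1) ^ 2) < real (self_power x * self_power (x + 2))"
    by (simp add: self_power_def N_def power_mult[symmetric] algebra_simps eval_nat_numeral power_add)
  then show ?thesis by (simp only: of_nat_less_iff)
qed

text \<open>Log-convexity makes consecutive ratios increase: multiply the case c = b - 1 by
  log-convexity at b and cancel \<open>self_power c * self_power b\<close>.\<close>

lemma self_power_ratio_less:
  assumes "a < b"
  shows "self_power (a + 1) * self_power b < self_power a * self_power (b + 1)"
  using assms
proof (induction b rule: less_induct)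
  case (less b)
  obtain c where b: "b = c + 1" using less.prems by (cases b) auto
  have lc: "self_power b * self_power b < self_power c * self_power (b + 1)"
    using self_power_log_convex[of c] by (simp add: b power2_eq_square)
  show ?case
  proof (cases "c = a")
    case True
    then show ?thesis using lc b by simp
  next
    case False
    then have "self_power (a + 1) * self_power c < self_power a * self_power b"
      using less.IH[of c] less.prems b by auto
    then have "self_power (a + 1) * self_power c * (self_power b * self_power b) <
        self_power a * self_power b * (self_power c * self_power (b + 1))"
      using lc by (rule mult_strict_mono) (auto simp: self_power_pos)
    then show ?thesis by (simp add: mult.left_commute mult.assoc)
  qed
qed

text \<open>The ratio comparisons for c successive units telescope. Both sides have the same sum of
  arguments, so this is the exchange that pushes two summands apart.\<close>

lemma self_power_shift_less:
  assumes "a < b" and "0 < c"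
  shows "self_power (a + c) * self_power b < self_power a * self_power (b + c)"
  using \<open>0 < c\<close>
proof (induction c rule: nat_induct_non_zero)
  case 1
  then show ?case using self_power_ratio_less[OF \<open>a < b\<close>] by simp
next
  case (Suc c)
  have "self_power (a + c + 1) * self_power (b + c) < self_power (a + c) * self_power (b + c + 1)"
    using self_power_ratio_less[of "a + c" "b + c"] \<open>a < b\<close> by simp
  with Suc.IH have "self_power (a + c) * self_power b *
        (self_power (a + c + 1) * self_power (b + c)) <
      self_power a * self_power (b + c) * (self_power (a + c) * self_power (b + c + 1))"
    by (rule mult_strict_mono) (auto simp: self_power_pos)
  then show ?case by (simp add: mult_ac self_power_pos)
qed

section \<open>Growth of the greedy product with the sum\<close>

definition greedy_prod :: "nat \<Rightarrow> nat \<Rightarrow> nat" where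
  "greedy_prod M S = self_power M ^ (S div M) * self_power (S mod M)"

lemma greedy_prod_add_cap:
  "0 < M \<Longrightarrow> greedy_prod M (S + M) = self_power M * greedy_prod M S"
  by (simp add: greedy_prod_def)

text \<open>Merging z with the nonzero remainder s pushes the pair apart: it becomes 0 and s + z or,
  once s + z reaches M, s + z - M and M.\<close>

lemma greedy_prod_add_less:
  assumes "0 < z" "z < M" "S mod M \<noteq> 0"
  shows "self_power z * greedy_prod M S < greedy_prod M (S + z)"
proof -
  define q s where "q = S div M" and "s = S mod M"
  have S: "S = q * M + s" and s: "0 < s" "s < M"
    using assms by (auto simp: q_def s_def)
  have "self_power z * self_power s * self_power M ^ q < greedy_prod M (S + z)"
  proof (cases "s + z < M")
    case True
    then have "(S + z) div M = q" "(S + z) mod M = s + z"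
      by (simp_all add: S add.assoc)
    then show ?thesis
      using self_power_shift_less[of 0 z s] assms s
      by (simp add: greedy_prod_def self_power_0 self_power_pos add.commute mult.commute)
  next
    case False
    then have "S + z = (q + 1) * M + (s + z - M)" "s + z - M < M"
      using S s assms by auto
    then have "(S + z) div M = q + 1" "(S + z) mod M = s + z - M"
      by (metis div_mult_self3 add.commute add_cancel_right_left div_less gr_implies_not0)
         (metis \<open>S + z = _\<close> \<open>s + z - M < M\<close> mod_less mod_mult_self3)
    moreover have "self_power z * self_power s < self_power (s + z - M) * self_power M"
      using self_power_shift_less[of "s + z - M" s "M - s"] assms s False by simp
    ultimately show ?thesis
      by (simp add: greedy_prod_def self_power_pos mult.assoc mult.left_commute mult.commute)
  qed
  then show ?thesis by (simp add: greedy_prod_def q_def s_def mult.assoc mult.commute mult.left_commute)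
qed

text \<open>Split Suc M as M + 1: the M brings a factor \<open>self_power M\<close>, the 1 raises
  the remainder s to s + 1, and s < M lets the ratio comparison apply.\<close>

lemma greedy_prod_Suc_cap_less:
  assumes "0 < M"
  shows "greedy_prod M (R + Suc M) < self_power (Suc M) * greedy_prod M R"
proof -
  define q s where "q = R div M" and "s = R mod M"
  have s: "s < M" and R: "R = q * M + s" using assms by (auto simp: q_def s_def)
  \<comment> \<open>Also valid for s + 1 = M, where the division gives q + 1 full parts and
    remainder 0, since \<open>self_power 0 = 1\<close>.\<close>
  have "greedy_prod M (R + 1) = self_power M ^ q * self_power (s + 1)"
  proof (cases "s + 1 < M")
    case True
    then have "(R + 1) div M = q" "(R + 1) mod M = s + 1"
      using assms by (simp_all add: R add.assoc del: add_Suc_right)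
    then show ?thesis by (simp add: greedy_prod_def)
  next
    case False
    then have "R + 1 = (q + 1) * M" using R s by simp
    then have "(R + 1) div M = q + 1" "(R + 1) mod M = 0"
      using assms by (metis nonzero_mult_div_cancel_right not_less0, simp)
    moreover have "s + 1 = M" using False s by simp
    ultimately show ?thesis by (simp add: greedy_prod_def self_power_0)
  qed
  moreover have "self_power M * self_power (s + 1) < self_power (Suc M) * self_power s"
    using self_power_ratio_less[OF s] by (simp add: mult.commute)
  ultimately show ?thesis
    using greedy_prod_add_cap[OF assms, of "R + 1"]
    by (simp add: greedy_prod_def q_def s_def self_power_pos mult.left_commute)
qed

lemma greedy_prod_multiple_Suc_cap_le:
  assumes "0 < M"
  shows "greedy_prod M (R + k * Suc M) \<le> self_power (Suc M) ^ k * greedy_prod M R"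
proof (induction k)
  case (Suc k)
  have "greedy_prod M (R + Suc k * Suc M) < self_power (Suc M) * greedy_prod M (R + k * Suc M)"
    using greedy_prod_Suc_cap_less[OF assms, of "R + k * Suc M"] by (simp add: add_ac)
  also have "\<dots> \<le> self_power (Suc M) * (self_power (Suc M) ^ k * greedy_prod M R)"
    using Suc.IH by simp
  finally show ?case by (simp add: mult.assoc)
qed simp

text \<open>One strict trade and k - 1 weak ones. It will exclude equality when all entries are at
  most M.\<close>

lemma greedy_prod_multiple_Suc_cap_less:
  assumes "0 < M" "0 < k"
  shows "greedy_prod M (R + k * Suc M) < self_power (Suc M) ^ k * greedy_prod M R"
proof -
  obtain j where k: "k = Suc j" using assms by (cases k) auto
  have "greedy_prod M (R + k * Suc M) < self_power (Suc M) * greedy_prod M (R + j * Suc M)"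
    using greedy_prod_Suc_cap_less[OF assms(1), of "R + j * Suc M"] by (simp add: add_ac k)
  also have "\<dots> \<le> self_power (Suc M) * (self_power (Suc M) ^ j * greedy_prod M R)"
    using greedy_prod_multiple_Suc_cap_le[OF assms(1)] by simp
  finally show ?thesis by (simp add: mult.assoc k)
qed

section \<open>Maximality of the greedy product over multisets\<close>

text \<open>Induction adding one entry at a time. Equality fixes only the positive entries, because
  a zero changes neither product nor sum.\<close>

lemma prod_mset_le_greedy_prod:
  assumes "0 < M" "\<forall>x\<in>#N. x \<le> M"
  shows "prod_mset (image_mset self_power N) \<le> greedy_prod M (sum_mset N)"
    and "prod_mset (image_mset self_power N) = greedy_prod M (sum_mset N) \<Longrightarrow>
      filter_mset (\<lambda>x. 0 < x) N = replicate_mset (sum_mset N div M) M +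
        filter_mset (\<lambda>x. 0 < x) {#sum_mset N mod M#}"
proof -
  let ?P = "\<lambda>N. prod_mset (image_mset self_power N)"
  let ?pos = "filter_mset (\<lambda>x::nat. 0 < x)"
  have "?P N \<le> greedy_prod M (sum_mset N) \<and> (?P N = greedy_prod M (sum_mset N) \<longrightarrow>
      ?pos N = replicate_mset (sum_mset N div M) M + ?pos {#sum_mset N mod M#})"
    using assms(2)
  proof (induction N)
    case empty
    then show ?case by (simp add: greedy_prod_def self_power_0)
  next
    case (add z N)
    let ?S = "sum_mset N"
    have IH: "?P N \<le> greedy_prod M ?S"
      "?P N = greedy_prod M ?S \<Longrightarrow> ?pos N = replicate_mset (?S div M) M + ?pos {#?S mod M#}"
      using add by auto
    have step: "self_power z * ?P N \<le> self_power z * greedy_prod M ?S" using IH(1) by simp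
    \<comment> \<open>In the first three cases z is invisible, a further full part, or the new
      remainder, so the greedy form persists. In the fourth, merging gains strictly and equality is
      impossible.\<close>
    consider "z = 0" | "z = M" | "0 < z" "z < M" "?S mod M = 0" | "0 < z" "z < M" "?S mod M \<noteq> 0"
      using add.prems by fastforce
    then show ?case
    proof cases
      case 1
      then show ?thesis using IH by (simp add: self_power_0)
    next
      case 2
      then show ?thesis
        using IH assms(1) greedy_prod_add_cap[OF assms(1), of ?S] self_power_pos[of M]
        by (auto simp: add.commute)
    next
      case 3
      then have d: "(z + ?S) div M = ?S div M" "(z + ?S) mod M = z" by auto
      then have "greedy_prod M (z + ?S) = self_power z * greedy_prod M ?S"
        by (simp add: greedy_prod_def 3 self_power_0)
      then show ?thesis using IH 3 d self_power_pos[of z] by auto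
    next
      case 4
      then have "self_power z * ?P N < greedy_prod M (z + ?S)"
        using greedy_prod_add_less[of z M ?S] step by (metis add.commute le_less_trans neq0_conv)
      then show ?thesis by simp
    qed
  qed
  then show "?P N \<le> greedy_prod M (sum_mset N)"
    and "?P N = greedy_prod M (sum_mset N) \<Longrightarrow>
      ?pos N = replicate_mset (sum_mset N div M) M + ?pos {#sum_mset N mod M#}" by auto
qed

text \<open>Restores the zeros that the equality case leaves open: the size determines their
  number.\<close>

lemma mset_eq_positive_part_plus_zeros:
  fixes N :: "nat multiset"
  shows "N = filter_mset (\<lambda>x. 0 < x) N + replicate_mset (size N - size (filter_mset (\<lambda>x. 0 < x) N)) 0"
proof -
  have 1: "N = filter_mset (\<lambda>x. 0 < x) N + filter_mset (\<lambda>x. x = 0) N"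
    using multiset_partition[of N "\<lambda>x. 0 < x"] by simp
  moreover have "filter_mset (\<lambda>x. x = 0) N = replicate_mset (count N 0) 0"
    using filter_eq_replicate_mset[of 0 N] by metis
  ultimately show ?thesis by (metis diff_add_inverse size_replicate_mset size_union)
qed

text \<open>The extremal problem without graphs: entries stand for degrees minus one. In the
  optimum, z counts the zeros besides the remainder entry, which may itself be 0.\<close>

lemma prod_mset_max_count:
  fixes X :: "nat multiset"
  assumes k: "0 < k" "2 * k \<le> sum_mset X"
    and m: "\<forall>x\<in>#X. x \<le> m" "count X m = k"
    and D: "D = sum_mset X div k" and R: "R = sum_mset X - k * D"
    and sz: "size X = k + R div (D - 1) + 1 + z"
  defines "B \<equiv> self_power D ^ k * greedy_prod (D - 1) R"
  shows "prod_mset (image_mset self_power X) \<le> B"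
    and "prod_mset (image_mset self_power X) = B \<longleftrightarrow>
      X = replicate_mset k D + replicate_mset (R div (D - 1)) (D - 1) + {#R mod (D - 1)#} +
        replicate_mset z 0"
proof -
  let ?P = "\<lambda>N. prod_mset (image_mset self_power N)"
  let ?pos = "filter_mset (\<lambda>x::nat. 0 < x)"
  define M where "M = D - 1"
  have "2 \<le> D" unfolding D using k by (simp add: less_eq_div_iff_mult_less_eq)
  then have M: "0 < M" and DM: "D = Suc M" by (auto simp: M_def)
  have S: "sum_mset X = R + k * D" unfolding R D by simp
  define Y where "Y = filter_mset (\<lambda>x. x \<noteq> m) X"
  have X: "X = replicate_mset k m + Y"
    using multiset_partition[of X "\<lambda>x. x = m"] m(2) filter_eq_replicate_mset[of m X]
    by (simp add: Y_def)
  have Y: "\<forall>x\<in>#Y. x < m" using m(1) by (auto simp: Y_def)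
  \<comment> \<open>The k maximal entries alone contribute k * m, which bounds m by the floor
    D.\<close>
  have "k * m \<le> sum_mset X" by (subst X) simp
  then have mD: "m \<le> D" using k unfolding D by (simp add: less_eq_div_iff_mult_less_eq mult.commute)
  have attained: "?P X = B" if "X = replicate_mset k D + replicate_mset (R div M) M + {#R mod M#} +
        replicate_mset z 0"
    by (subst that) (simp add: B_def greedy_prod_def M_def self_power_0 mult.assoc)
  have "?P X \<le> B \<and> (?P X = B \<longrightarrow> X = replicate_mset k D + replicate_mset (R div M) M +
      {#R mod M#} + replicate_mset z 0)"
  proof (cases "m = D")
    case False
    then have "\<forall>x\<in>#X. x \<le> M" using mD m(1) DM by fastforce
    then have "?P X \<le> greedy_prod M (sum_mset X)" by (rule prod_mset_le_greedy_prod[OF M])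
    also have "\<dots> < B"
      using greedy_prod_multiple_Suc_cap_less[OF M k(1), of R] by (simp add: B_def S DM)
    finally show ?thesis by simp
  next
    case True
    have YM: "\<forall>x\<in>#Y. x \<le> M" using Y DM True by auto
    have "sum_mset X = k * D + sum_mset Y" by (subst X) (simp add: True)
    then have YR: "sum_mset Y = R" using S by simp
    have PX: "?P X = self_power D ^ k * ?P Y" by (subst X) (simp add: True)
    have le: "?P Y \<le> greedy_prod M R"
      using prod_mset_le_greedy_prod(1)[OF M YM] YR by simp
    have eq: "X = replicate_mset k D + replicate_mset (R div M) M + {#R mod M#} +
        replicate_mset z 0" if "?P X = B"
    proof -
      have "?P Y = greedy_prod M R"
        using that self_power_pos[of D] by (simp add: PX B_def M_def)
      then have pos: "?pos Y = replicate_mset (R div M) M + ?pos {#R mod M#}"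
        using prod_mset_le_greedy_prod(2)[OF M YM] YR by simp
      have "size X = k + size Y" by (subst X) simp
      then have "size Y = R div M + 1 + z" using sz by (simp add: M_def)
      \<comment> \<open>The size fixes the number of zeros. If R mod M = 0, the remainder entry is
        one of them, hence the case split.\<close>
      then have "Y = replicate_mset (R div M) M + {#R mod M#} + replicate_mset z 0"
        using mset_eq_positive_part_plus_zeros[of Y] pos by (auto split: if_splits)
      then show ?thesis using X True by (simp add: add.assoc)
    qed
    then show ?thesis using le by (simp add: PX B_def M_def)
  qed
  with attained show "?P X \<le> B" "?P X = B \<longleftrightarrow>
      X = replicate_mset k D + replicate_mset (R div (D - 1)) (D - 1) + {#R mod (D - 1)#} +
        replicate_mset z 0"
    unfolding M_def by blast+
qed

subsection \<open>Degrees in trees\<close>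

context pair_graph
begin

section \<open>Edge count of a tree\<close>

lemma card_arcs_tree:
  assumes conn: "connected (with_proj G)"
    and acyclic: "\<not> (\<exists>c. cycle c \<and> 3 \<le> length c)"
  shows "card (parcs G) = 2 * (card (pverts G) - 1)"
proof -
  \<comment> \<open>Grow a vertex set \<open>W\<close> one neighbour at a time, keeping paths inside \<open>W\<close>: a new vertex
    with two neighbours in \<open>W\<close> would close a cycle of length at least three.\<close>
  have sc: "strongly_connected (with_proj G)"
    using symmetric_connected_imp_strongly_connected[OF pair_sym_arcs conn] .
  then obtain r where r: "r \<in> pverts G" by (auto simp: strongly_connected_def)
  let ?in = "\<lambda>W. parcs G \<inter> W \<times> W"
  let ?joined = "\<lambda>W u v. \<exists>p. apath u p v \<and> set (pawalk_verts u p) \<subseteq> W"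
  \<comment> \<open>The m edges inside W are 2 * m arcs. Paths inside W are part of the invariant
    because one of them has to close the cycle through the new vertex.\<close>
  have grow: "\<exists>W \<subseteq> pverts G. card W = Suc m \<and> card (?in W) = 2 * m \<and>
      (\<forall>u\<in>W. \<forall>v\<in>W. ?joined W u v)" if "m < card (pverts G)" for m
    using that
  proof (induction m)
    case 0
    have "?in {r} = {}" using pair_no_loops by fastforce
    moreover have "?joined {r} r r" using r by (intro exI[of _ "[]"]) (simp add: apath_Nil_iff)
    ultimately show ?case using r by (intro exI[of _ "{r}"]) auto
  next
    case (Suc m)
    then obtain W where W: "W \<subseteq> pverts G" "card W = Suc m" "card (?in W) = 2 * m"
      and joined: "\<And>u v. u \<in> W \<Longrightarrow> v \<in> W \<Longrightarrow> ?joined W u v" by auto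
    have "finite W" using W(2) by (auto intro: card_ge_0_finite)
    obtain a where a: "a \<in> W" using W(2) by fastforce
    obtain b where b: "b \<in> pverts G" "b \<notin> W"
      using Suc.prems W(1,2) by (metis less_irrefl subsetI subset_antisym)
    \<comment> \<open>Otherwise W would contain every vertex reachable from a, including b.\<close>
    have "\<exists>u w. u \<in> W \<and> w \<notin> W \<and> (u, w) \<in> parcs G"
    proof (rule ccontr)
      assume closed: "\<nexists>u w. u \<in> W \<and> w \<notin> W \<and> (u, w) \<in> parcs G"
      have "a \<rightarrow>\<^sup>*\<^bsub>with_proj G\<^esub> b"
        using sc a b W(1) by (auto simp: strongly_connected_def)
      then have "b \<in> W" by (induction rule: reachable_induct) (use a closed in auto)
      with b show False by simp
    qed
    then obtain u w where uw: "u \<in> W" "w \<notin> W" "(u, w) \<in> parcs G" by blast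
    have wu: "(w, u) \<in> parcs G" using uw(3) pair_sym_arcs by (auto simp: symmetric_def sym_def)
    have w: "w \<in> pverts G" using uw(3) by (rule in_arcsD2)
    have unique: "v = u" if v: "v \<in> W" "(v, w) \<in> parcs G" for v
    proof (rule ccontr)
      assume "v \<noteq> u"
      obtain p where p: "apath u p v" "set (pawalk_verts u p) \<subseteq> W" using joined uw(1) v(1) by blast
      \<comment> \<open>Nonemptiness of p gives the cycle w, u, ..., v, w its three arcs; p stays in
        W and so avoids w.\<close>
      have "p \<noteq> []" using p(1) \<open>v \<noteq> u\<close> by (auto simp: apath_Nil_iff)
      let ?c = "(w, u) # p @ [(v, w)]"
      have aw: "awalk u p v" and dist: "distinct (pawalk_verts u p)" using p(1) by (auto simp: apath_def)
      have tail: "awalk u (p @ [(v, w)]) w" using aw v(2) w by (auto simp: awalk_simps)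
      then have "awalk w ?c w" using wu by (simp only: awalk_Cons_iff fst_conv snd_conv)
      moreover have "pawalk_verts u (p @ [(v, w)]) = pawalk_verts u p @ [w]"
        using awalk_verts_append[OF tail] aw by simp
      then have "distinct (tl (pawalk_verts w ?c))" using dist p(2) uw(2) by auto
      ultimately have "cycle ?c" by (auto simp: cycle_def)
      moreover have "3 \<le> length ?c" using \<open>p \<noteq> []\<close> by (cases p) auto
      ultimately show False using acyclic by blast
    qed
    let ?W = "insert w W"
    have unique': "v = u" if "v \<in> W" "(w, v) \<in> parcs G" for v
      using that pair_sym_arcs by (intro unique) (auto simp: symmetric_def sym_def)
    have "(w, w) \<notin> parcs G" using pair_no_loops by fastforce
    \<comment> \<open>As u is the only neighbour of w in W, exactly one edge, that is two arcs, is
      added.\<close>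
    then have "?in ?W = ?in W \<union> {(u, w), (w, u)}"
      using uw wu by (auto dest: unique unique')
    moreover have "card (?in W \<union> {(u, w), (w, u)}) = card (?in W) + card {(u, w), (w, u)}"
      using uw \<open>finite W\<close> by (intro card_Un_disjoint) auto
    moreover have "u \<noteq> w" using uw by auto
    ultimately have "card (?in ?W) = 2 * Suc m" using W(3) by simp
    moreover have "card ?W = Suc (Suc m)" using W(2) uw(2) \<open>finite W\<close> by simp
    moreover have "?joined ?W x y" if xy: "x \<in> ?W" "y \<in> ?W" for x y
    proof -
      consider "x \<in> W" "y \<in> W" | "x = w" "y = w" | "x = w" "y \<in> W" | "x \<in> W" "y = w"
        using xy by blast
      then show ?thesis
      proof cases
        case 1
        then show ?thesis using joined by blast
      next
        case 2
        then show ?thesis using w by (intro exI[of _ "[]"]) (simp add: apath_Nil_iff)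
      next
        case 3
        obtain p where "apath u p y" "set (pawalk_verts u p) \<subseteq> W" using joined uw(1) 3 by blast
        then show ?thesis using wu uw(2) 3 by (intro exI[of _ "(w, u) # p"]) (auto simp: apath_Cons_iff)
      next
        case 4
        obtain p where p: "apath x p u" "set (pawalk_verts x p) \<subseteq> W" using joined uw(1) 4 by blast
        then have aw: "awalk x p u" "distinct (pawalk_verts x p)" by (auto simp: apath_def)
        then have "awalk x (p @ [(u, w)]) w" using uw(3) w by (auto simp: awalk_simps)
        moreover from awalk_verts_append[OF this] have "pawalk_verts x (p @ [(u, w)]) = pawalk_verts x p @ [w]"
          using aw by simp
        ultimately show ?thesis using aw(2) p(2) uw(2) 4
          by (intro exI[of _ "p @ [(u, w)]"]) (auto simp: apath_def)
      qed
    qed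
    ultimately show ?case using W(1) w by (intro exI[of _ ?W]) blast
  qed
  have "0 < card (pverts G)" using r pair_finite_verts by (auto simp: card_gt_0_iff)
  then obtain W where W: "W \<subseteq> pverts G" "card W = card (pverts G)"
    "card (?in W) = 2 * (card (pverts G) - 1)"
    using grow[of "card (pverts G) - 1"] by auto
  then have "W = pverts G" using card_subset_eq[OF pair_finite_verts] by blast
  moreover have "?in (pverts G) = parcs G" by (auto dest: in_arcsD1 in_arcsD2)
  ultimately show ?thesis using W(3) by simp
qed

section \<open>Vertex degrees and the index as a product over vertices\<close>

text \<open>Each arc is counted at its tail. The 2 of the handshake identity sits in
  \<open>parcs\<close>, which holds both directions of an edge.\<close>

lemma sum_deg: "(\<Sum>v\<in>pverts G. deg G v) = card (parcs G)"
proof -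
  have "parcs G = (\<Union>v\<in>pverts G. out_arcs (with_proj G) v)"
    by (auto dest: in_arcsD1)
  also have "card \<dots> = (\<Sum>v\<in>pverts G. card (out_arcs (with_proj G) v))"
    by (intro card_UN_disjoint) (auto simp: pair_finite_verts)
  finally show ?thesis by (simp add: out_degree_def)
qed

text \<open>A walk to another vertex starts with an arc at v. Positivity later makes subtracting 1
  from degrees reversible.\<close>

lemma deg_pos:
  assumes "connected (with_proj G)" "2 \<le> card (pverts G)" "v \<in> pverts G"
  shows "0 < deg G v"
proof -
  obtain w where w: "w \<in> pverts G" "w \<noteq> v"
    using assms(2,3) by (metis card_le_Suc0_iff_eq not_less_eq_eq numeral_2_eq_2 pair_finite_verts)
  have "v \<rightarrow>\<^sup>*\<^bsub>with_proj G\<^esub> w"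
    using symmetric_connected_imp_strongly_connected[OF pair_sym_arcs assms(1)] assms(3) w
    by (auto simp: strongly_connected_def)
  then obtain x where "(v, x) \<in> parcs G"
    using w(2) by (cases rule: converse_reachable_cases) auto
  then have "(v, x) \<in> out_arcs (with_proj G) v" by simp
  then show ?thesis unfolding out_degree_def by (metis card_gt_0_iff empty_iff finite_out_arcs)
qed

text \<open>Exchange the products over incident pairs: v contributes the factor
  \<open>deg G v\<close> once for each edge containing it.\<close>

lemma zagreb2_mult_eq_prod: "zagreb2_mult G = (\<Prod>v\<in>pverts G. deg G v ^ deg G v)"
proof -
  have sub: "e \<subseteq> pverts G" if "e \<in> uedges G" for e
    using that by (auto simp: uedges_def dest: in_arcsD1 in_arcsD2)
  have fin: "finite (uedges G)"
    using sub by (intro finite_subset[OF _ finite_Pow_iff[THEN iffD2, OF pair_finite_verts]]) blast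
  have deg: "card {e \<in> uedges G. v \<in> e} = deg G v" for v
  proof -
    \<comment> \<open>Each edge at v has one orientation starting at v, supplied by the symmetry of
      the arcs.\<close>
    have "bij_betw (\<lambda>(x, y). {x, y}) (out_arcs (with_proj G) v) {e \<in> uedges G. v \<in> e}"
      unfolding bij_betw_def
    proof
      show "inj_on (\<lambda>(x, y). {x, y}) (out_arcs (with_proj G) v)"
        by (auto simp: inj_on_def doubleton_eq_iff)
      show "(\<lambda>(x, y). {x, y}) ` out_arcs (with_proj G) v = {e \<in> uedges G. v \<in> e}"
      proof (intro set_eqI iffI)
        fix e assume "e \<in> {e \<in> uedges G. v \<in> e}"
        then obtain x y where "e = {x, y}" "(x, y) \<in> parcs G" "v = x \<or> v = y"
          by (auto simp: uedges_def)
        moreover have "(y, x) \<in> parcs G"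
          using calculation pair_sym_arcs by (auto simp: symmetric_def sym_def)
        ultimately obtain z where "e = {v, z}" "(v, z) \<in> parcs G" by auto
        then show "e \<in> (\<lambda>(x, y). {x, y}) ` out_arcs (with_proj G) v"
          by (intro image_eqI[of _ _ "(v, z)"]) auto
      qed (force simp: uedges_def)
    qed
    then show ?thesis by (simp add: bij_betw_same_card out_degree_def)
  qed
  have "zagreb2_mult G = (\<Prod>e\<in>uedges G. \<Prod>v\<in>{v \<in> pverts G. v \<in> e}. deg G v)"
    unfolding zagreb2_mult_def
  proof (intro prod.cong refl)
    fix e assume "e \<in> uedges G"
    then show "e = {v \<in> pverts G. v \<in> e}" using sub by blast
  qed
  also have "\<dots> = (\<Prod>v\<in>pverts G. \<Prod>e\<in>{e \<in> uedges G. v \<in> e}. deg G v)"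
    by (rule prod.swap_restrict[OF fin pair_finite_verts])
  finally show ?thesis by (simp add: deg)
qed

end

text \<open>A sorted list is determined by its multiset, so the equality case can be settled on
  multisets.\<close>

lemma degree_sequence_eq_iff:
  assumes "sorted (rev xs)"
  shows "degree_sequence G = xs \<longleftrightarrow> image_mset (deg G) (mset_set (pverts G)) = mset xs"
proof -
  have "degree_sequence G = xs \<longleftrightarrow>
      sorted_list_of_multiset (image_mset (deg G) (mset_set (pverts G))) = rev xs"
    by (auto simp: degree_sequence_def)
  also have "\<dots> \<longleftrightarrow> image_mset (deg G) (mset_set (pverts G)) = mset xs"
  proof
    assume "sorted_list_of_multiset (image_mset (deg G) (mset_set (pverts G))) = rev xs"
    then show "image_mset (deg G) (mset_set (pverts G)) = mset xs"
      using mset_sorted_list_of_multiset[of "image_mset (deg G) (mset_set (pverts G))"] by simp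
  next
    assume "image_mset (deg G) (mset_set (pverts G)) = mset xs"
    then have "sorted_list_of_multiset (image_mset (deg G) (mset_set (pverts G))) = sort (rev xs)"
      by (metis mset_rev sorted_list_of_multiset_mset)
    with assms show "sorted_list_of_multiset (image_mset (deg G) (mset_set (pverts G))) = rev xs"
      by (simp add: sorted_sort_id)
  qed
  finally show ?thesis .
qed

subsection \<open>The extremal trees\<close>

theorem theorem4p2:
  fixes n k \<Delta> p \<mu> :: nat and T :: "'a pair_pre_digraph"
  assumes "1 \<le> k" and "real k \<le> real n / 2 - 1"
    and "T \<in> tree_class n k"
    and "\<Delta> = (n - 2) div k + 1"
    and "p = (n - 2 - k * (\<Delta> - 1)) div (\<Delta> - 2)"
    and "\<mu> = n - 1 - k * (\<Delta> - 1) - p * (\<Delta> - 2)"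
  shows "zagreb2_mult T \<le> \<Delta> ^ (k * \<Delta>) * (\<Delta> - 1) ^ (p * (\<Delta> - 1)) * \<mu> ^ \<mu> \<and>
    (zagreb2_mult T = \<Delta> ^ (k * \<Delta>) * (\<Delta> - 1) ^ (p * (\<Delta> - 1)) * \<mu> ^ \<mu> \<longleftrightarrow>
     degree_sequence T =
       replicate k \<Delta> @ replicate p (\<Delta> - 1) @ [\<mu>] @ replicate (n - k - p - 1) 1)"
proof -
  note par = parameters_nat[OF assms(1,2,4-6)]
  have tree: "undirected_tree T" and n: "card (pverts T) = n"
    and k: "card {v \<in> pverts T. deg T v = max_deg T} = k"
    using assms(3) by (auto simp: tree_class_def)
  interpret pair_graph T using tree by (simp add: undirected_tree_def)
  have conn: "connected (with_proj T)" and "\<not> (\<exists>c. cycle c \<and> 3 \<le> length c)"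
    using tree by (auto simp: undirected_tree_def)
  then have arcs: "card (parcs T) = 2 * (n - 1)" using card_arcs_tree n by simp
  have kn: "2 * k + 2 \<le> n" using assms(2) by linarith
  have pos: "0 < deg T v" if "v \<in> pverts T" for v using deg_pos[OF conn] that n kn by simp
  define V where "V = mset_set (pverts T)"
  have fin: "finite (pverts T)" by (rule pair_finite_verts)
  define X where "X = image_mset (\<lambda>v. deg T v - 1) V"
  have Suc_X: "image_mset Suc X = image_mset (deg T) V"
    unfolding X_def multiset.map_comp
    by (rule image_mset_cong) (use pos fin in \<open>auto simp: V_def\<close>)
  have size: "size X = n" by (simp add: X_def V_def n)
  \<comment> \<open>One unit per vertex undoes the subtraction, so the sum is 2 * (n - 1) -
    n.\<close>
  have "sum_mset X + n = (\<Sum>v\<in>pverts T. deg T v - 1 + 1)"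
    by (simp only: sum.distrib X_def V_def sum_unfold_sum_mset[symmetric]) (simp add: n)
  also have "\<dots> = (\<Sum>v\<in>pverts T. deg T v)" by (rule sum.cong) (use pos in auto)
  finally have sum: "sum_mset X = n - 2" using sum_deg arcs kn by simp
  have le: "\<forall>x\<in>#X. x \<le> max_deg T - 1"
    unfolding X_def V_def max_deg_def using fin by (auto intro!: diff_le_mono)
  have "max_deg T \<in> deg T ` pverts T"
    unfolding max_deg_def using fin n kn by (intro Max_in) auto
  then have "0 < max_deg T" using pos by auto
  have "count X (max_deg T - 1) = card {v \<in> pverts T. max_deg T - 1 = deg T v - 1}"
    using fin by (simp add: X_def V_def count_image_mset' card_eq_sum[symmetric] Int_def conj_commute)
  \<comment> \<open>Truncated subtraction identifies degrees 0 and 1; positivity rules that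
    out.\<close>
  also have "{v \<in> pverts T. max_deg T - 1 = deg T v - 1} = {v \<in> pverts T. deg T v = max_deg T}"
    using pos \<open>0 < max_deg T\<close> by fastforce
  finally have count: "count X (max_deg T - 1) = k" using k by simp
  define R where "R = n - 2 - k * (\<Delta> - 1)"
  define z where "z = n - k - p - 1"
  have M: "\<Delta> - 2 = \<Delta> - 1 - 1" by simp
  have p: "p = R div (\<Delta> - 1 - 1)" using assms(5) by (simp add: R_def M)
  have kD: "k * (\<Delta> - 1) \<le> n - 2" using assms(4) by simp
  have \<mu>: "\<mu> = Suc (R mod (\<Delta> - 1 - 1))"
  proof -
    have "\<mu> = Suc R - p * (\<Delta> - 2)" using assms(6) kD kn by (simp add: R_def)
    moreover have "R = p * (\<Delta> - 2) + R mod (\<Delta> - 2)"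
      unfolding p M by (rule div_mult_mod_eq[symmetric])
    ultimately show ?thesis by (simp add: M)
  qed
  let ?Y = "replicate_mset k (\<Delta> - 1) + replicate_mset p (\<Delta> - 2) + {#\<mu> - 1#} + replicate_mset z 0"
  let ?L = "replicate k \<Delta> @ replicate p (\<Delta> - 1) @ [\<mu>] @ replicate z 1"
  let ?B = "\<Delta> ^ (k * \<Delta>) * (\<Delta> - 1) ^ (p * (\<Delta> - 1)) * \<mu> ^ \<mu>"
  have sz: "size X = k + R div (\<Delta> - 1 - 1) + 1 + z" using size par(6) p by (simp add: z_def)
  have B: "self_power (\<Delta> - 1) ^ k * greedy_prod (\<Delta> - 1 - 1) R = ?B"
    using par(2) \<mu> p by (simp add: greedy_prod_def self_power_def power_mult[symmetric] mult.commute
        Suc_diff_Suc mult.assoc)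
  have zag: "zagreb2_mult T = prod_mset (image_mset self_power X)"
  proof -
    have "zagreb2_mult T = prod_mset (image_mset (\<lambda>d. d ^ d) (image_mset (deg T) V))"
      by (simp add: zagreb2_mult_eq_prod prod_unfold_prod_mset V_def multiset.map_comp comp_def)
    then show ?thesis by (simp add: Suc_X[symmetric] multiset.map_comp comp_def self_power_def[abs_def])
  qed
  have "\<Delta> - 1 = sum_mset X div k" "R = sum_mset X - k * (\<Delta> - 1)"
    using assms(4) by (simp_all add: sum R_def)
  note main = prod_mset_max_count[OF _ _ le count this sz]
  have "zagreb2_mult T \<le> ?B" "zagreb2_mult T = ?B \<longleftrightarrow> X = ?Y"
    using main kn assms(1) unfolding B zag by (simp_all add: sum p \<mu> M)
  moreover have "X = ?Y \<longleftrightarrow> degree_sequence T = ?L"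
  proof -
    \<comment> \<open>As a remainder plus one, \<mu> lies between 1 and \<Delta> - 1, so the claimed
      list is non-increasing.\<close>
    have "\<mu> \<le> \<Delta> - 1" using \<mu> par(2) mod_less_divisor[of "\<Delta> - 1 - 1" R] by linarith
    then have "sorted (rev ?L)" using par(5) by (auto simp: sorted_append)
    then have "degree_sequence T = ?L \<longleftrightarrow> image_mset Suc X = mset ?L"
      by (simp only: degree_sequence_eq_iff Suc_X V_def)
    also have "mset ?L = image_mset Suc ?Y"
    proof -
      have "Suc (\<Delta> - 1) = \<Delta>" "Suc (\<Delta> - 2) = \<Delta> - 1" "Suc (\<mu> - 1) = \<mu>" using par(2,5) by simp_all
      then show ?thesis by simp
    qed
    finally show ?thesis by (metis multiset.inj_map inj_Suc injD)
  qed
  ultimately show ?thesis unfolding z_def by simp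
qed

end
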